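(* Let $\preceq$ be a strongly artinian preorder on a monoid $H$ and let $s \ge 2$ be an integer such that, for every $x \in H$ that is neither a $\preceq$-unit nor a $\preceq$-quark, there exist an integer $k$ with $2 \le k \le s$ and $\preceq$-non-units $y_1, \ldots, y_k \in H$ such that $x = y_1 \cdots y_k$, $y_i \preceq x$ for each $i \in \{1, \ldots, k\}$, and $\mathrm{ht}(y_1) + \cdots + \mathrm{ht}(y_k) \le \mathrm{ht}(x) + k - 2$. Then the following hold: (i) The preorder $\preceq$ is artinian, every $\preceq$-non-unit of $H$ factors as a finite product of $\preceq$-irreducibles of degree $s$, and every $\preceq$-irreducible of degree $s$ is a $\preceq$-quark. (ii) Each $\preceq$-non-unit $x \in H$ is a product of $(s-1)\,\mathrm{ht}(x) - (s-2)$ or fewer $\preceq$-quarks.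
   Context: A monoid is a semigroup with identity $1_H$ (not necessarily commutative or cancellative). A preorder $\preceq$ on $H$ is a reflexive and transitive relation on the set $H$ (no compatibility with multiplication is assumed). Write $x \prec y$ if $x \preceq y$ and $y \not\preceq x$. The preorder is artinian if there is no infinite sequence $(x_k)_{k\ge 0}$ in $H$ with $x_{k+1} \prec x_k$ for all $k$. An element $u \in H$ is a $\preceq$-unit if $u \preceq 1_H \preceq u$, and a $\preceq$-non-unit otherwise. A $\preceq$-quark is a $\preceq$-non-unit $a \in H$ such that there is no $\preceq$-non-unit $b \in H$ with $b \prec a$. For an integer $s \ge 2$, a $\preceq$-irreducible of degree $s$ is a $\preceq$-non-unit $a \in H$ such that for every integer $k$ with $2 \le k \le s$ there are no $\preceq$-non-units $b_1, \ldots, b_k \in H$ with $b_i \prec a$ for all $i$ and $a = b_1 \cdots b_k$. The $\preceq$-height $\mathrm{ht}(x) \in \mathbb{N} \cup \{\infty\}$ of $x \in H$ is the supremum of the set of all integers $n \ge 1$ for which there are $\preceq$-non-units $x_1, \ldots, x_n \in H$ with $x_1 = x$ and $x_{k+1} \prec x_k$ for $1 \le k \le n-1$, with $\sup\emptyset := 0$. The preorder is strongly artinian if $\mathrm{ht}(x) < \infty$ for every $x \in H$. *)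

theory Defs
  imports Main "HOL-Library.Extended_Nat"
begin

text \<open>
  Throughout, the monoid is the universe of a type of class \<open>monoid_mult\<close>, and the preorder is an
  arbitrary binary relation \<open>le\<close> on it, unrelated to any type-class order.
  A \<open>k\<close>-tuple of factors is a list of length \<open>k\<close>, and its product is \<open>prod_list\<close>.
\<close>

definition strict :: "('a \<Rightarrow> 'a \<Rightarrow> bool) \<Rightarrow> 'a \<Rightarrow> 'a \<Rightarrow> bool" where
  "strict le x y \<longleftrightarrow> le x y \<and> \<not> le y x"

definition artinian :: "('a \<Rightarrow> 'a \<Rightarrow> bool) \<Rightarrow> bool" where
  "artinian le \<longleftrightarrow> (\<nexists>x :: nat \<Rightarrow> 'a. \<forall>k. strict le (x (Suc k)) (x k))"

definition le_unit :: "('a::monoid_mult \<Rightarrow> 'a \<Rightarrow> bool) \<Rightarrow> 'a \<Rightarrow> bool" where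
  "le_unit le u \<longleftrightarrow> le u 1 \<and> le 1 u"

abbreviation non_unit :: "('a::monoid_mult \<Rightarrow> 'a \<Rightarrow> bool) \<Rightarrow> 'a \<Rightarrow> bool" where
  "non_unit le a \<equiv> \<not> le_unit le a"

definition quark :: "('a::monoid_mult \<Rightarrow> 'a \<Rightarrow> bool) \<Rightarrow> 'a \<Rightarrow> bool" where
  "quark le a \<longleftrightarrow> non_unit le a \<and> (\<nexists>b. non_unit le b \<and> strict le b a)"

definition irreducible_of_degree ::
    "('a::monoid_mult \<Rightarrow> 'a \<Rightarrow> bool) \<Rightarrow> nat \<Rightarrow> 'a \<Rightarrow> bool" where
  "irreducible_of_degree le s a \<longleftrightarrow> non_unit le a \<and>
     (\<forall>k. 2 \<le> k \<and> k \<le> s \<longrightarrow>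
        (\<nexists>bs. length bs = k \<and> (\<forall>b\<in>set bs. non_unit le b \<and> strict le b a) \<and> a = prod_list bs))"

text \<open>In \<^typ>\<open>enat\<close>, the supremum of the empty set is \<open>0\<close> and that of an unbounded set is \<open>\<infinity>\<close>.\<close>

definition height :: "('a::monoid_mult \<Rightarrow> 'a \<Rightarrow> bool) \<Rightarrow> 'a \<Rightarrow> enat" where
  "height le x = Sup {enat n | n. n \<ge> 1 \<and>
     (\<exists>c :: nat \<Rightarrow> 'a. c 1 = x \<and> (\<forall>k\<in>{1..n}. non_unit le (c k)) \<and>
        (\<forall>k\<in>{1..n - 1}. strict le (c (k + 1)) (c k)))}"

definition strongly_artinian :: "('a::monoid_mult \<Rightarrow> 'a \<Rightarrow> bool) \<Rightarrow> bool" where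
  "strongly_artinian le \<longleftrightarrow> (\<forall>x. height le x < \<infinity>)"

end

theory Submission
  imports Defs
begin

text \<open>
  Equivalent non-units have the same height. If a non-unit \<open>x\<close> that is not a quark is written as
  \<open>y\<^sub>1 \<cdots> y\<^sub>k\<close> as in the hypothesis, then, every factor having height at least 1, the bound on the
  sum of the heights forces \<open>ht(y\<^sub>i) < ht(x)\<close>. Together with \<open>y\<^sub>i \<preceq> x\<close> this makes every factor
  strictly smaller than \<open>x\<close>, so \<open>x\<close> is not irreducible; and induction on the height, splitting \<open>x\<close>
  repeatedly, yields a factorization into quarks, whose length is controlled since
  \<open>(s - 1)(h + k - 2) - k(s - 2) = (s - 1)h + k - 2(s - 1) \<le> (s - 1)h - (s - 2)\<close> for \<open>k \<le> s\<close>.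
\<close>

lemma le_height_if_chain:
  assumes "n \<ge> 1" "c 1 = x" "\<And>k. k \<in> {1..n} \<Longrightarrow> non_unit le (c k)"
    and "\<And>k. k \<in> {1..n - 1} \<Longrightarrow> strict le (c (k + 1)) (c k)"
  shows "enat n \<le> height le x"
  unfolding height_def using assms by (intro Sup_upper) blast

lemma one_le_height_if_non_unit:
  assumes "non_unit le x"
  shows "1 \<le> height le x"
  using le_height_if_chain[of 1 "\<lambda>_. x" x le] assms by (simp add: one_enat_def)

text \<open>Whatever lies strictly below \<open>x\<close> lies strictly below \<open>y\<close> by
  transitivity, so a chain of non-units starting at \<open>x\<close> stays one when its first entry
  is replaced by \<open>y\<close>.\<close>

lemma height_mono:
  assumes "transp le" "le x y" "non_unit le y"
  shows "height le x \<le> height le y"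
  unfolding height_def[of le x]
proof (rule Sup_least, clarify)
  fix n and c :: "nat \<Rightarrow> 'a"
  assume n: "1 \<le> n" and x: "x = c 1" and nu: "\<forall>k\<in>{1..n}. non_unit le (c k)"
    and st: "\<forall>k\<in>{1..n - 1}. strict le (c (k + 1)) (c k)"
  define d where "d = c(1 := y)"
  show "enat n \<le> height le y"
  proof (rule le_height_if_chain[of n d])
    fix k assume k: "k \<in> {1..n - 1}"
    then have "strict le (c (k + 1)) (c k)" using st by blast
    then show "strict le (d (k + 1)) (d k)"
      using k assms(1,2) x unfolding d_def strict_def by (auto dest: transpD)
  qed (use n nu assms(3) in \<open>auto simp: d_def\<close>)
qed

lemma artinian_if_strongly_artinian:
  assumes "transp le" "strongly_artinian le"
  shows "artinian le"
  unfolding artinian_def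
proof
  assume "\<exists>x. \<forall>k. strict le (x (Suc k)) (x k)"
  then obtain x where x: "strict le (x (Suc k)) (x k)" for k by blast
  have tr: "le a b \<Longrightarrow> le b c \<Longrightarrow> le a c" for a b c using assms(1) by (blast dest: transpD)
  have desc: "strict le (x j) (x i)" if "i < j" for i j
    using that
  proof (induction rule: less_Suc_induct)
    case (2 i j k)
    then show ?case unfolding strict_def by (blast intro: tr)
  qed (rule x)
  \<comment> \<open>A strictly descending chain meets the class of the identity at most once.\<close>
  have "\<exists>m. \<forall>k>m. non_unit le (x k)"
  proof (rule ccontr)
    assume "\<not> ?thesis"
    then obtain i j where "i < j" "le_unit le (x i)" "le_unit le (x j)" by blast
    then have "le (x i) (x j)" unfolding le_unit_def by (blast intro: tr)
    then show False using desc[OF \<open>i < j\<close>] unfolding strict_def by blast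
  qed
  then obtain m where m: "k > m \<Longrightarrow> non_unit le (x k)" for k by blast
  \<comment> \<open>The tail beyond index \<open>m\<close> has initial segments of every length, so
    the height of its first entry would be infinite.\<close>
  have "enat n \<le> height le (x (m + 1))" if "n \<ge> 1" for n
    using that x m by (intro le_height_if_chain[of n "\<lambda>k. x (m + k)"]) auto
  moreover obtain h where "height le (x (m + 1)) = enat h"
    using assms(2) unfolding strongly_artinian_def by (metis less_infinityE)
  ultimately have "enat (Suc h) \<le> enat h" by (metis le_add1 plus_1_eq_Suc)
  then show False by simp
qed

lemma irreducible_of_degree_if_quark:
  assumes "quark le a"
  shows "irreducible_of_degree le s a"
proof -
  \<comment> \<open>Since \<open>k \<ge> 2\<close>, the list is nonempty, and its first entry
    already contradicts the quark property.\<close>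
  have False if "k \<ge> 2" "length bs = k" "\<forall>b\<in>set bs. non_unit le b \<and> strict le b a" for k bs
    using that assms by (cases bs) (auto simp: quark_def)
  then show ?thesis using assms unfolding irreducible_of_degree_def quark_def by blast
qed

text \<open>The remaining \<open>length ys - 1\<close> entries contribute at least 1 each. With
  \<open>f\<close> the height, this isolates a single factor in the bound on the sum.\<close>

lemma member_add_length_le_sum_list:
  fixes f :: "'a \<Rightarrow> nat"
  assumes "\<And>y. y \<in> set ys \<Longrightarrow> 1 \<le> f y" "y \<in> set ys"
  shows "f y + (length ys - 1) \<le> sum_list (map f ys)"
proof -
  have len: "(\<And>y. y \<in> set zs \<Longrightarrow> 1 \<le> f y) \<Longrightarrow> length zs \<le> sum_list (map f zs)" for zs
  proof (induction zs)
    case (Cons z zs)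
    then have "1 \<le> f z" "length zs \<le> sum_list (map f zs)" by auto
    then show ?case by simp
  qed simp
  obtain us vs where ys: "ys = us @ y # vs" using assms(2) by (meson split_list)
  have "length us \<le> sum_list (map f us)" "length vs \<le> sum_list (map f vs)"
    using assms(1) ys by (auto intro!: len)
  then show ?thesis using ys by simp
qed

text \<open>Concatenating the factorizations adds up their bounds. The slack \<open>c\<close>, later
  \<open>s - 2\<close>, is gained once per factor.\<close>

lemma concat_factorizations:
  fixes f :: "'a::monoid_mult \<Rightarrow> nat"
  assumes "\<And>y. y \<in> set ys \<Longrightarrow>
    \<exists>as. (\<forall>a\<in>set as. P a) \<and> y = prod_list as \<and> length as + c \<le> d * f y"
  shows "\<exists>as. (\<forall>a\<in>set as. P a) \<and> prod_list ys = prod_list as \<and>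
    length as + length ys * c \<le> d * sum_list (map f ys)"
  using assms
proof (induction ys)
  case Nil
  show ?case by (rule exI[of _ "[]"]) simp
next
  case (Cons y ys)
  obtain as where "\<forall>a\<in>set as. P a" "y = prod_list as" "length as + c \<le> d * f y"
    using Cons.prems[of y] by auto
  moreover have "\<exists>as. (\<forall>a\<in>set as. P a) \<and> prod_list ys = prod_list as \<and>
      length as + length ys * c \<le> d * sum_list (map f ys)"
    by (rule Cons.IH, rule Cons.prems) simp
  then obtain bs where "\<forall>a\<in>set bs. P a" "prod_list ys = prod_list bs"
      "length bs + length ys * c \<le> d * sum_list (map f ys)"
    by blast
  ultimately show ?case by (intro exI[of _ "as @ bs"]) (auto simp: algebra_simps)
qed

lemma quark_factorization_length_bound:
  fixes s k h S L :: nat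
  assumes "2 \<le> k" "k \<le> s" "S \<le> h + (k - 2)" "L + k * (s - 2) \<le> (s - 1) * S"
  shows "L + (s - 2) \<le> (s - 1) * h"
proof -
  \<comment> \<open>The shifts by 2 remove truncated subtraction; after cancellation the claim
    reduces to \<open>j \<le> t\<close>, that is \<open>k \<le> s\<close>.\<close>
  obtain j where k: "k = j + 2" using assms(1) by (metis le_add_diff_inverse2)
  obtain t where s: "s = t + 2" using assms(1,2) by (metis le_add_diff_inverse2 le_trans)
  have "(t + 1) * S \<le> (t + 1) * (h + j)" using assms(3) k by (intro mult_left_mono) auto
  then show ?thesis using assms(2,4) by (simp add: k s algebra_simps)
qed

theorem theorem3p5:
  fixes le :: "'a::monoid_mult \<Rightarrow> 'a \<Rightarrow> bool" and s :: nat
  assumes "reflp le" and "transp le"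
    and "strongly_artinian le"
    and "s \<ge> 2"
    and "\<And>x. \<not> le_unit le x \<Longrightarrow> \<not> quark le x \<Longrightarrow>
           \<exists>k ys. 2 \<le> k \<and> k \<le> s \<and> length ys = k \<and> (\<forall>y\<in>set ys. non_unit le y) \<and>
             x = prod_list ys \<and> (\<forall>y\<in>set ys. le y x) \<and>
             sum_list (map (height le) ys) \<le> height le x + enat (k - 2)"
  shows "(artinian le \<and>
          (\<forall>x. non_unit le x \<longrightarrow>
             (\<exists>as. (\<forall>a\<in>set as. irreducible_of_degree le s a) \<and> x = prod_list as)) \<and>
          (\<forall>a. irreducible_of_degree le s a \<longrightarrow> quark le a)) \<and>
         (\<forall>x. non_unit le x \<longrightarrow>
             (\<exists>as. (\<forall>a\<in>set as. quark le a) \<and> x = prod_list as \<and>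
                enat (length as) \<le> enat (s - 1) * height le x - enat (s - 2)))"
proof -
  define h where "h x = the_enat (height le x)" for x
  have h: "height le x = enat (h x)" for x
    using assms(3) unfolding strongly_artinian_def h_def by (metis less_infinityE the_enat.simps)
  have h_pos: "1 \<le> h x" if "non_unit le x" for x
    using one_le_height_if_non_unit[OF that] by (simp add: h one_enat_def)
  have h_sum: "sum_list (map (height le) ys) = enat (sum_list (map h ys))" for ys
    by (induction ys) (simp_all add: h zero_enat_def)
  have split: "\<exists>ys. 2 \<le> length ys \<and> length ys \<le> s \<and> x = prod_list ys \<and>
      sum_list (map h ys) \<le> h x + (length ys - 2) \<and>
      (\<forall>y\<in>set ys. non_unit le y \<and> strict le y x \<and> h y < h x)"
    if x: "non_unit le x" "\<not> quark le x" for x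
  proof -
    obtain ys where ys: "2 \<le> length ys" "length ys \<le> s" "\<forall>y\<in>set ys. non_unit le y"
        "x = prod_list ys" "\<forall>y\<in>set ys. le y x"
        "sum_list (map (height le) ys) \<le> height le x + enat (length ys - 2)"
      using assms(5)[OF x] by blast
    have sum: "sum_list (map h ys) \<le> h x + (length ys - 2)"
      using ys(6) by (simp add: h h_sum)
    \<comment> \<open>Here \<open>h y + (k - 1) \<le> h x + (k - 2)\<close> for
      \<open>k = length ys\<close>, and \<open>k \<ge> 2\<close> makes both subtractions
      exact.\<close>
    have less: "h y < h x" if "y \<in> set ys" for y
      using member_add_length_le_sum_list[of ys h y] that ys(1,3) h_pos sum by fastforce
    \<comment> \<open>If also \<open>le x y\<close>, monotonicity would give
      \<open>h x \<le> h y\<close>.\<close>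
    have "strict le y x" if "y \<in> set ys" for y
      using less[OF that] that ys(3,5) height_mono[OF assms(2), of x y]
      by (auto simp: strict_def h)
    then show ?thesis using ys sum less by blast
  qed
  \<comment> \<open>The term \<open>s - 2\<close> stands on the left so that the induction avoids
    truncated subtraction.\<close>
  have quarks: "\<exists>as. (\<forall>a\<in>set as. quark le a) \<and> x = prod_list as \<and>
      length as + (s - 2) \<le> (s - 1) * h x" if "non_unit le x" for x
    using that
  proof (induction "h x" arbitrary: x rule: less_induct)
    case less
    show ?case
    proof (cases "quark le x")
      case True
      have "(s - 1) * 1 \<le> (s - 1) * h x"
        using h_pos[OF less.prems] by (intro mult_left_mono) auto
      then have "1 + (s - 2) \<le> (s - 1) * h x" using assms(4) by linarith
      then show ?thesis using True by (intro exI[of _ "[x]"]) auto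
    next
      case False
      then obtain ys where ys: "2 \<le> length ys" "length ys \<le> s" "x = prod_list ys"
          "sum_list (map h ys) \<le> h x + (length ys - 2)"
          "\<forall>y\<in>set ys. non_unit le y \<and> strict le y x \<and> h y < h x"
        using split[OF less.prems] by blast
      obtain as where as: "\<forall>a\<in>set as. quark le a" "prod_list ys = prod_list as"
          "length as + length ys * (s - 2) \<le> (s - 1) * sum_list (map h ys)"
        using concat_factorizations[of ys "quark le" "s - 2" "s - 1" h] less.hyps ys(5) by blast
      show ?thesis
        using quark_factorization_length_bound[OF ys(1,2,4) as(3)] as(1,2) ys(3) by auto
    qed
  qed
  have "quark le a" if "irreducible_of_degree le s a" for a
    using that split[of a] unfolding irreducible_of_degree_def by blast
  moreover have "\<exists>as. (\<forall>a\<in>set as. irreducible_of_degree le s a) \<and> x = prod_list as"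
    if "non_unit le x" for x
    using quarks[OF that] irreducible_of_degree_if_quark by blast
  moreover have "\<exists>as. (\<forall>a\<in>set as. quark le a) \<and> x = prod_list as \<and>
      enat (length as) \<le> enat (s - 1) * height le x - enat (s - 2)" if "non_unit le x" for x
    \<comment> \<open>The additive bound implies \<open>s - 2 \<le> (s - 1) * h x\<close>, so the
      subtraction in the claim is exact.\<close>
    using quarks[OF that] by (auto simp: h le_diff_conv2)
  ultimately show ?thesis
    using artinian_if_strongly_artinian[OF assms(2,3)] by blast
qed

end
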